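(* Let $q$ be a complex number with $|q|<1$. Then the following three identities hold: \begin{align*} \sum_{i,j,k\ge 0}\frac{q^{\frac{1}{2}i^2+2j^2+4k^2+ij+4jk+\frac{1}{2}i}}{(q;q)_i(q;q)_j(q^2;q^2)_k} &=\frac{(q^6,q^8,q^{14};q^{14})_\infty}{(q;q)_\infty},\\ \sum_{i,j,k\ge 0}\frac{q^{\frac{1}{2}i^2+2j^2+4k^2+ij+4jk+\frac{1}{2}i+2k}}{(q;q)_i(q;q)_j(q^2;q^2)_k} &=\frac{(q^4,q^{10},q^{14};q^{14})_\infty}{(q;q)_\infty},\\ \sum_{i,j,k\ge 0}\frac{q^{\frac{1}{2}i^2+2j^2+4k^2+ij+4jk+\frac{1}{2}i+2j+4k}}{(q;q)_i(q;q)_j(q^2;q^2)_k} &=\frac{(q^2,q^{12},q^{14};q^{14})_\infty}{(q;q)_\infty}. \end{align*}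
   Context: For $|q|<1$: $(a;q)_\infty=\prod_{m=0}^\infty(1-aq^m)$, $(a;q)_n=(a;q)_\infty/(aq^n;q)_\infty=\prod_{m=0}^{n-1}(1-aq^m)$ for integers $n\ge0$, and $(a_1,\dots,a_r;q)_\infty=(a_1;q)_\infty\cdots(a_r;q)_\infty$; the same notation is used with the base $q$ replaced by a power of $q$. All exponents of $q$ in the sums are integers. *)

theory Defs
  imports "HOL-Analysis.Analysis"
begin

definition qpoch :: "complex \<Rightarrow> complex \<Rightarrow> nat \<Rightarrow> complex" where
  "qpoch a q n = (\<Prod>m<n. 1 - a * q ^ m)"

text \<open>Only meaningful for \<open>norm q < 1\<close>, where the product converges (in the sense of
  \<open>has_prod\<close>, which allows finitely many zero factors).\<close>

definition qpoch_inf :: "complex \<Rightarrow> complex \<Rightarrow> complex" where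
  "qpoch_inf a q = (\<Prod>m. 1 - a * q ^ m)"

definition qpoch_inf_list :: "complex list \<Rightarrow> complex \<Rightarrow> complex" where
  "qpoch_inf_list as q = (\<Prod>a\<leftarrow>as. qpoch_inf a q)"

end

theory Submission
  imports Defs
begin

text \<open>
  The sum over $i$ is one of Euler's sums, with value $(-q^{j+1};q)_\<infinity> = (-q;q)_\<infinity>/(-q;q)_j$.  Since
  $(q;q)_j(-q;q)_j = (q^2;q^2)_j$, what remains is $(-q;q)_\<infinity>$ times
  \[ \sum_{j,k \<ge> 0} \frac{Q^{(j+k)^2 + k^2 + c(j+k) + ak}}{(Q;Q)_j (Q;Q)_k}, \qquad Q = q^2, \]
  with $(a,c) = (0,0), (1,0), (1,1)$ for the three identities.  These are the Andrews-Gordon identities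
  modulo 7: the double sum is $(Q^{3+2a+c}, Q^{4-2a-c}, Q^7; Q^7)_\<infinity>/(Q;Q)_\<infinity>$.  As
  $(-q;q)_\<infinity>/(q^2;q^2)_\<infinity> = 1/(q;q)_\<infinity>$, the theorem follows.

  The Andrews-Gordon identities come from a Bailey chain.  The finite triple product at $x = 1$ says that
  the sequence $(-1)^s q^{s(s-1)/2}$ forms a Bailey pair with the sequence $1, 0, 0, \ldots$; three
  applications of the Bailey lemma, which rests on a $q$-Vandermonde sum, multiply the former by powers
  of $q$ with quadratic exponents and turn the latter into an iterated sum.  In the mixed case $a = 1$,
  $c = 0$ the parameter of the pair has to be lowered before the last step; an antisymmetry makes this
  possible.  When $n$ tends to infinity the iterated sum becomes the double sum above, and the bilateral
  sum on the other side is evaluated by the Jacobi triple product.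

  The Jacobi triple product and Euler's sum are themselves limits of the finite triple product, so this
  one identity, the $q$-Vandermonde sum and Tannery's theorem carry the whole proof.
\<close>

section \<open>Reciprocals of q-factorials and the finite triple product\<close>

text \<open>
  The reciprocal $1/(q;q)_m$ for integer $m$, with the usual convention that it is zero for $m < 0$.
  With this convention the recurrence $1/(q;q)_{m-1} = (1 - q^m)/(q;q)_m$ holds for every integer $m$, and
  sums may be extended or shifted without boundary terms.
\<close>

definition inv_qpoch :: "complex \<Rightarrow> int \<Rightarrow> complex" where
  "inv_qpoch q m = (if m < 0 then 0 else inverse (qpoch q q (nat m)))"

definition tri :: "int \<Rightarrow> int" where
  "tri r = r * (r - 1) div 2"

lemma two_tri: "2 * tri r = r * (r - 1)"
  unfolding tri_def by (simp add: algebra_simps)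

lemma tri_add_one: "tri (r + 1) = tri r + r"
  using two_tri[of r] two_tri[of "r + 1"] by (simp add: algebra_simps)

lemma norm_power_less_one:
  fixes q :: complex
  assumes "norm q < 1" "n > 0" shows "norm (q ^ n) < 1"
  using assms by (simp add: norm_power power_less_one_iff)

lemma power_neq_one:
  fixes q :: complex
  assumes "norm q < 1" shows "q ^ Suc n \<noteq> 1"
proof
  assume "q ^ Suc n = 1"
  then have "norm q ^ Suc n = 1" by (metis norm_one norm_power)
  moreover have "norm q ^ Suc n < 1" using power_Suc_less_one[of "norm q" n] assms by (cases "q = 0") auto
  ultimately show False by simp
qed

lemma qpoch_Suc: "qpoch a q (Suc n) = qpoch a q n * (1 - a * q ^ n)"
  by (simp add: qpoch_def)

lemma qpoch_self_nonzero:
  assumes "norm q < 1" shows "qpoch q q n \<noteq> 0"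
  using power_neq_one[OF assms] by (auto simp: qpoch_def)

lemma convergent_prod_qpoch:
  assumes "norm (q::complex) < 1"
  shows "convergent_prod (\<lambda>m. 1 - a * q ^ m)"
proof -
  have "summable (\<lambda>m. norm a * norm q ^ m)"
    using assms by (intro summable_mult summable_geometric) auto
  then have "summable (\<lambda>m. norm ((1 - a * q ^ m) - 1))"
    by (simp add: norm_mult norm_power)
  then show ?thesis
    by (intro abs_convergent_prod_imp_convergent_prod summable_imp_abs_convergent_prod)
qed

lemma qpoch_tendsto:
  assumes "norm q < 1"
  shows "(\<lambda>n. qpoch a q n) \<longlonglongrightarrow> qpoch_inf a q"
  unfolding qpoch_def qpoch_inf_def LIMSEQ_lessThan_iff_atMost
  by (rule convergent_prod_LIMSEQ[OF convergent_prod_qpoch[OF assms]])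

lemma qpoch_inf_self_nonzero:
  assumes "norm q < 1" shows "qpoch_inf q q \<noteq> 0"
  unfolding qpoch_inf_def
  using power_neq_one[OF assms] convergent_prod_qpoch[OF assms]
  by (intro prodinf_nonzero) auto

lemma inv_qpoch_neg: "m < 0 \<Longrightarrow> inv_qpoch q m = 0"
  by (simp add: inv_qpoch_def)

lemma inv_qpoch_of_nat: "inv_qpoch q (int n) = inverse (qpoch q q n)"
  by (simp add: inv_qpoch_def)

lemma inv_qpoch_zero: "inv_qpoch q 0 = 1"
  by (simp add: inv_qpoch_def qpoch_def)

lemma inv_qpoch_pred:
  assumes "norm q < 1"
  shows "inv_qpoch q (m - 1) = (1 - q powi m) * inv_qpoch q m"
proof -
  consider "m < 0" | "m = 0" | n where "m = int (Suc n)"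
    by (metis int_cases not0_implies_Suc of_nat_0 neg_less_0_iff_less of_nat_0_less_iff zero_less_Suc)
  then show ?thesis
  proof cases
    case (3 n)
    have "inv_qpoch q m * (1 - q ^ Suc n) = inv_qpoch q (int n)"
      unfolding 3 inv_qpoch_of_nat using qpoch_self_nonzero[OF assms, of n] power_neq_one[OF assms, of n]
      by (simp add: qpoch_Suc field_simps)
    moreover have "m - 1 = int n" "q powi m = q ^ Suc n"
      using 3 by (auto simp flip: power_int_of_nat)
    ultimately show ?thesis by (metis mult.commute)
  qed (auto simp: inv_qpoch_def)
qed

lemma inv_qpoch_tendsto:
  assumes "norm q < 1"
  shows "(\<lambda>n. inv_qpoch q (int n + m)) \<longlonglongrightarrow> inverse (qpoch_inf q q)"
proof -
  have "(\<lambda>n. inverse (qpoch q q n)) \<longlonglongrightarrow> inverse (qpoch_inf q q)"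
    by (intro tendsto_inverse qpoch_tendsto qpoch_inf_self_nonzero assms)
  moreover have "filterlim (\<lambda>n. nat (int n + m)) sequentially sequentially"
    unfolding filterlim_at_top
  proof
    fix Z show "\<forall>\<^sub>F n in sequentially. Z \<le> nat (int n + m)"
      by (rule eventually_sequentiallyI[of "Z + nat \<bar>m\<bar>"]) auto
  qed
  ultimately have "(\<lambda>n. inverse (qpoch q q (nat (int n + m)))) \<longlonglongrightarrow> inverse (qpoch_inf q q)"
    by (rule filterlim_compose)
  moreover have "\<forall>\<^sub>F n in sequentially. inverse (qpoch q q (nat (int n + m))) = inv_qpoch q (int n + m)"
    by (rule eventually_sequentiallyI[of "nat \<bar>m\<bar>"]) (auto simp: inv_qpoch_def)
  ultimately show ?thesis by (rule Lim_transform_eventually)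
qed

lemma inv_qpoch_bounded:
  assumes "norm q < 1"
  obtains C where "\<And>m. norm (inv_qpoch q m) \<le> C"
proof -
  have "Bseq (\<lambda>n. inv_qpoch q (int n + 0))"
    using inv_qpoch_tendsto[OF assms] convergent_def convergent_imp_Bseq by blast
  then obtain C where C: "\<And>n. norm (inv_qpoch q (int n)) \<le> C" by (auto simp: Bseq_def)
  show ?thesis
  proof (rule that[of C])
    have "C \<ge> 1" using C[of 0] by (simp add: inv_qpoch_zero)
    then show "norm (inv_qpoch q m) \<le> C" for m
      using C by (cases m rule: int_cases2) (auto simp: inv_qpoch_def)
  qed
qed

lemma one_minus_mult: "1 - u * v = (1 - u) + u * (1 - v :: complex)"
  by (simp add: algebra_simps)

text \<open>
  This is the $q$-binomial theorem written symmetrically: with $N = n + m$ and the summation index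
  shifted by $m$ it expands a product of $N$ linear factors.  It is used three times below.  For
  $x = 1$ the right-hand side vanishes unless $n = 0$, which is the seed of the Bailey chain;
  $n = m \<rightarrow> \<infinity>$ gives the Jacobi triple product; $m = 0$, $n \<rightarrow> \<infinity>$ gives Euler's sum.

  The proof adds one factor at a time.  The enlarged sum is multiplied by
  $1 - q^{n+m+1} = 1 - uv = (1 - u) + u(1 - v)$, where $u$ and $v$ depend on $s$ and are chosen such that
  $1 - u$ and $1 - v$ each cancel the last factor of one of the two denominators.  The first part is then
  the smaller sum and the second, after a shift of $s$, a multiple of it.
\<close>

lemma finite_triple_product:
  assumes q: "norm q < 1" "q \<noteq> 0" and x: "x \<noteq> 0"
  shows "(\<Sum>s = - int m..int n. (-x) powi s * q powi tri s * inv_qpoch q (int n - s) * inv_qpoch q (int m + s))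
    = qpoch x q n * qpoch (q / x) q m * inv_qpoch q (int n + int m)"
proof -
  define F where "F n m = (\<Sum>s = - int m..int n. (-x) powi s * q powi tri s * inv_qpoch q (int n - s) * inv_qpoch q (int m + s))" for n m
  have pw: "q powi (a + b) = q powi a * q powi b" for a b using q by (simp add: power_int_add)
  have stepn: "(1 - q powi (int n + int m + 1)) * F (Suc n) m = (1 - x * q ^ n) * F n m" for n m
  proof -
    define A where "A = {- int m..int (Suc n)}"
    have "(1 - q powi (int n + int m + 1)) * F (Suc n) m
      = (\<Sum>s\<in>A. (-x) powi s * q powi tri s * inv_qpoch q (int n - s) * inv_qpoch q (int m + s))
       + (\<Sum>s\<in>A. q powi (int n + 1 - s) * ((-x) powi s * q powi tri s * inv_qpoch q (int n + 1 - s) * inv_qpoch q (int m + s - 1)))"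
      unfolding F_def sum_distrib_left A_def[symmetric] sum.distrib[symmetric]
    proof (rule sum.cong)
      fix s
      have e1: "inv_qpoch q (int n - s) = (1 - q powi (int n + 1 - s)) * inv_qpoch q (int n + 1 - s)"
        using inv_qpoch_pred[OF q(1), of "int n + 1 - s"] by simp
      have e2: "inv_qpoch q (int m + s - 1) = (1 - q powi (int m + s)) * inv_qpoch q (int m + s)"
        using inv_qpoch_pred[OF q(1), of "int m + s"] by simp
      have e3: "q powi (int n + int m + 1) = q powi (int n + 1 - s) * q powi (int m + s)"
        by (simp add: algebra_simps flip: pw)
      have e4: "int (Suc n) - s = int n + 1 - s" by simp
      show "(1 - q powi (int n + int m + 1)) * ((- x) powi s * q powi tri s * inv_qpoch q (int (Suc n) - s) * inv_qpoch q (int m + s)) =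
         (- x) powi s * q powi tri s * inv_qpoch q (int n - s) * inv_qpoch q (int m + s) +
         q powi (int n + 1 - s) * ((- x) powi s * q powi tri s * inv_qpoch q (int n + 1 - s) * inv_qpoch q (int m + s - 1))"
        unfolding e1 e2 e3 e4 one_minus_mult by (simp only: distrib_left distrib_right mult_ac)
    qed simp
    \<comment> \<open>the term at the new upper end contains \<open>inv_qpoch q (- 1) = 0\<close>\<close>
    also have "(\<Sum>s\<in>A. (-x) powi s * q powi tri s * inv_qpoch q (int n - s) * inv_qpoch q (int m + s)) = F n m"
      unfolding F_def A_def by (rule sum.mono_neutral_right) (auto simp: inv_qpoch_neg)
    also have "(\<Sum>s\<in>A. q powi (int n + 1 - s) * ((-x) powi s * q powi tri s * inv_qpoch q (int n + 1 - s) * inv_qpoch q (int m + s - 1)))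
       = (\<Sum>s\<in>{- int m + 1..int n + 1}. q powi (int n + 1 - s) * ((-x) powi s * q powi tri s * inv_qpoch q (int n + 1 - s) * inv_qpoch q (int m + s - 1)))"
      unfolding A_def by (rule sum.mono_neutral_right) (auto simp: inv_qpoch_neg)
    also have "\<dots> = (\<Sum>s\<in>{- int m..int n}. - (x * q ^ n) * ((-x) powi s * q powi tri s * inv_qpoch q (int n - s) * inv_qpoch q (int m + s)))"
    proof (rule sum.reindex_bij_witness[of _ "\<lambda>s. s + 1" "\<lambda>s. s - 1"]; (simp; fail)?)
      fix s
      have "q powi (int n + 1 - s) * q powi tri s = q ^ n * q powi tri (s - 1)"
        using tri_add_one[of "s - 1"] by (simp flip: pw power_int_of_nat)
      moreover have "(-x) powi s = - x * (-x) powi (s - 1)"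
        using x power_int_add_1[of "-x" "s-1"] by simp
      ultimately show "- (x * q ^ n) * ((- x) powi (s - 1) * q powi tri (s - 1) * inv_qpoch q (int n - (s - 1)) * inv_qpoch q (int m + (s - 1))) =
         q powi (int n + 1 - s) * ((- x) powi s * q powi tri s * inv_qpoch q (int n + 1 - s) * inv_qpoch q (int m + s - 1))"
        by (simp add: algebra_simps)
    qed
    also have "\<dots> = - (x * q ^ n) * F n m" unfolding F_def sum_distrib_left ..
    finally show ?thesis by (simp add: algebra_simps)
  qed
  have stepm: "(1 - q powi (int n + int m + 1)) * F n (Suc m) = (1 - q / x * q ^ m) * F n m" for n m
  proof -
    define A where "A = {- int (Suc m)..int n}"
    have "(1 - q powi (int n + int m + 1)) * F n (Suc m)
      = (\<Sum>s\<in>A. (-x) powi s * q powi tri s * inv_qpoch q (int n - s) * inv_qpoch q (int m + s))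
       + (\<Sum>s\<in>A. q powi (int m + 1 + s) * ((-x) powi s * q powi tri s * inv_qpoch q (int n - s - 1) * inv_qpoch q (int m + 1 + s)))"
      unfolding F_def sum_distrib_left A_def[symmetric] sum.distrib[symmetric]
    proof (rule sum.cong)
      fix s
      have e1: "inv_qpoch q (int m + s) = (1 - q powi (int m + 1 + s)) * inv_qpoch q (int m + 1 + s)"
        using inv_qpoch_pred[OF q(1), of "int m + 1 + s"] by (simp add: algebra_simps)
      have e2: "inv_qpoch q (int n - s - 1) = (1 - q powi (int n - s)) * inv_qpoch q (int n - s)"
        using inv_qpoch_pred[OF q(1), of "int n - s"] by simp
      have e3: "q powi (int n + int m + 1) = q powi (int m + 1 + s) * q powi (int n - s)"
        by (simp add: algebra_simps flip: pw)
      have e4: "int (Suc m) + s = int m + 1 + s" by simp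
      show "(1 - q powi (int n + int m + 1)) * ((- x) powi s * q powi tri s * inv_qpoch q (int n - s) * inv_qpoch q (int (Suc m) + s)) =
         (- x) powi s * q powi tri s * inv_qpoch q (int n - s) * inv_qpoch q (int m + s) +
         q powi (int m + 1 + s) * ((- x) powi s * q powi tri s * inv_qpoch q (int n - s - 1) * inv_qpoch q (int m + 1 + s))"
        unfolding e1 e2 e3 e4 one_minus_mult by (simp only: distrib_left distrib_right mult_ac)
    qed simp
    also have "(\<Sum>s\<in>A. (-x) powi s * q powi tri s * inv_qpoch q (int n - s) * inv_qpoch q (int m + s)) = F n m"
      unfolding F_def A_def by (rule sum.mono_neutral_right) (auto simp: inv_qpoch_neg)
    also have "(\<Sum>s\<in>A. q powi (int m + 1 + s) * ((-x) powi s * q powi tri s * inv_qpoch q (int n - s - 1) * inv_qpoch q (int m + 1 + s)))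
       = (\<Sum>s\<in>{- int m - 1..int n - 1}. q powi (int m + 1 + s) * ((-x) powi s * q powi tri s * inv_qpoch q (int n - s - 1) * inv_qpoch q (int m + 1 + s)))"
      unfolding A_def by (rule sum.mono_neutral_right) (auto simp: inv_qpoch_neg)
    also have "\<dots> = (\<Sum>s\<in>{- int m..int n}. - (q / x * q ^ m) * ((-x) powi s * q powi tri s * inv_qpoch q (int n - s) * inv_qpoch q (int m + s)))"
    proof (rule sum.reindex_bij_witness[of _ "\<lambda>s. s - 1" "\<lambda>s. s + 1"]; (simp; fail)?)
      fix s
      have "q powi (int m + 1 + s) * q powi tri s = q powi (int m + 1) * q powi tri (s + 1)"
        using tri_add_one[of "s"] by (simp flip: pw add: algebra_simps)
      moreover have "q powi (int m + 1) = q * q ^ m"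
        using q by (simp add: power_int_add)
      moreover have "(-x) powi (s + 1) = - x * (-x) powi s"
        using x power_int_add_1[of "-x" "s"] by simp
      ultimately show "- (q / x * q ^ m) * ((- x) powi (s + 1) * q powi tri (s + 1) * inv_qpoch q (int n - (s + 1)) * inv_qpoch q (int m + (s + 1))) =
         q powi (int m + 1 + s) * ((- x) powi s * q powi tri s * inv_qpoch q (int n - s - 1) * inv_qpoch q (int m + 1 + s))"
        using x by (simp add: field_simps)
    qed
    also have "\<dots> = - (q / x * q ^ m) * F n m" unfolding F_def sum_distrib_left ..
    finally show ?thesis by (simp add: algebra_simps)
  qed
  have nz: "1 - q powi (int n + int m + 1) \<noteq> 0" for n m
    using power_neq_one[OF q(1), of "n + m"] by (simp add: nat_add_distrib power_int_def)
  have rq: "inv_qpoch q (int n + int m) = (1 - q powi (int n + int m + 1)) * inv_qpoch q (int n + int m + 1)" for n m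
    using inv_qpoch_pred[OF q(1), of "int n + int m + 1"] by simp
  have "F n 0 = qpoch x q n * inv_qpoch q (int n)" for n
  proof (induction n)
    case 0
    show ?case by (simp add: F_def inv_qpoch_zero qpoch_def tri_def)
  next
    case (Suc n)
    have r: "inv_qpoch q (int n) = (1 - q powi (int n + int 0 + 1)) * inv_qpoch q (int (Suc n))"
      using rq[of n 0] by (simp add: add.commute)
    have "(1 - q powi (int n + int 0 + 1)) * F (Suc n) 0
      = (1 - q powi (int n + int 0 + 1)) * (qpoch x q (Suc n) * inv_qpoch q (int (Suc n)))"
      unfolding stepn Suc r qpoch_Suc by (simp only: mult_ac)
    then show ?case using nz[of n 0] by (simp only: mult_cancel_left simp_thms)
  qed
  note base = this
  have "F n m = qpoch x q n * qpoch (q / x) q m * inv_qpoch q (int n + int m)"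
  proof (induction m)
    case 0
    show ?case using base by (simp add: qpoch_def)
  next
    case (Suc m)
    have r: "inv_qpoch q (int n + int m) = (1 - q powi (int n + int m + 1)) * inv_qpoch q (int n + int (Suc m))"
      using rq[of n m] by (simp add: add_ac)
    have "(1 - q powi (int n + int m + 1)) * F n (Suc m)
      = (1 - q powi (int n + int m + 1)) * (qpoch x q n * qpoch (q / x) q (Suc m) * inv_qpoch q (int n + int (Suc m)))"
      unfolding stepm Suc r qpoch_Suc by (simp only: mult_ac)
    then show ?case using nz[of n m] by (simp only: mult_cancel_left simp_thms)
  qed
  then show ?thesis unfolding F_def .
qed

section \<open>The Bailey chain\<close>
text \<open>
  A form of the $q$-Chu-Vandermonde sum.  In the step from $M$ to $M + 1$ the sum is multiplied by
  $1 - q^{M+1} = (1 - u) + u(1 - v)$ with $u = q^{M+1-t}$, $v = q^t$.  The second part is, after a shift of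
  $t$ and up to a power of $q$, the sum for $M$ with $c$ replaced by $c + 1$, so $c$ has to vary in the
  induction.
\<close>

lemma q_vandermonde_nat:
  assumes q: "norm q < 1"
  shows "(\<Sum>t\<le>M. q ^ (t * (t + c)) * inv_qpoch q (int t) * inv_qpoch q (int M - int t) * inv_qpoch q (int t + int c))
    = inv_qpoch q (int M) * inv_qpoch q (int M + int c)"
proof (induction M arbitrary: c)
  case 0
  show ?case by (simp add: inv_qpoch_zero)
next
  case (Suc M)
  define S where "S M c = (\<Sum>t\<le>M. q ^ (t * (t + c)) * inv_qpoch q (int t) * inv_qpoch q (int M - int t) * inv_qpoch q (int t + int c))" for M c
  have S: "S M c = inv_qpoch q (int M) * inv_qpoch q (int M + int c)" for c
    using Suc unfolding S_def by blast
  have "(1 - q ^ Suc M) * S (Suc M) c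
    = (\<Sum>t\<le>Suc M. q ^ (t * (t + c)) * inv_qpoch q (int t) * inv_qpoch q (int M - int t) * inv_qpoch q (int t + int c)
        + q ^ (Suc M - t) * q ^ (t * (t + c)) * inv_qpoch q (int t - 1) * inv_qpoch q (int (Suc M) - int t) * inv_qpoch q (int t + int c))"
    unfolding S_def sum_distrib_left
  proof (rule sum.cong)
    fix t assume t: "t \<in> {..Suc M}"
    have "q powi (int (Suc M) - int t) = q ^ (Suc M - t)"
      using t by (auto simp flip: power_int_of_nat)
    then have e1: "inv_qpoch q (int M - int t) = (1 - q ^ (Suc M - t)) * inv_qpoch q (int (Suc M) - int t)"
      using inv_qpoch_pred[OF q, of "int (Suc M) - int t"] by simp
    have e2: "inv_qpoch q (int t - 1) = (1 - q ^ t) * inv_qpoch q (int t)"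
      using inv_qpoch_pred[OF q, of "int t"] by simp
    have e3: "q ^ Suc M = q ^ (Suc M - t) * q ^ t"
      using t by (simp flip: power_add power_Suc)
    show "(1 - q ^ Suc M) * (q ^ (t * (t + c)) * inv_qpoch q (int t) * inv_qpoch q (int (Suc M) - int t) * inv_qpoch q (int t + int c)) =
         q ^ (t * (t + c)) * inv_qpoch q (int t) * inv_qpoch q (int M - int t) * inv_qpoch q (int t + int c) +
         q ^ (Suc M - t) * q ^ (t * (t + c)) * inv_qpoch q (int t - 1) * inv_qpoch q (int (Suc M) - int t) * inv_qpoch q (int t + int c)"
      unfolding e1 e2 e3 one_minus_mult by (simp only: distrib_left distrib_right mult_ac)
  qed simp
  also have "\<dots> = S M c + (\<Sum>t\<le>M. q ^ (M - t) * q ^ (Suc t * (Suc t + c)) * inv_qpoch q (int t) * inv_qpoch q (int M - int t) * inv_qpoch q (int (Suc t) + int c))"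
    unfolding sum.distrib S_def
    by (subst (2) sum.atMost_Suc_shift) (simp add: inv_qpoch_neg)
  also have "(\<Sum>t\<le>M. q ^ (M - t) * q ^ (Suc t * (Suc t + c)) * inv_qpoch q (int t) * inv_qpoch q (int M - int t) * inv_qpoch q (int (Suc t) + int c))
    = q ^ (Suc M + c) * S M (Suc c)"
    unfolding S_def sum_distrib_left
  proof (rule sum.cong)
    fix t assume t: "t \<in> {..M}"
    then obtain u where u: "M = t + u" by (auto simp: le_iff_add)
    have "q ^ (M - t) * q ^ (Suc t * (Suc t + c)) = q ^ (Suc M + c) * q ^ (t * (t + Suc c))"
      unfolding power_add[symmetric] by (rule arg_cong[of _ _ "power q"]) (simp add: u algebra_simps)
    moreover have "int (Suc t) + int c = int t + int (Suc c)" by simp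
    ultimately show "q ^ (M - t) * q ^ (Suc t * (Suc t + c)) * inv_qpoch q (int t) * inv_qpoch q (int M - int t) * inv_qpoch q (int (Suc t) + int c) =
         q ^ (Suc M + c) * (q ^ (t * (t + Suc c)) * inv_qpoch q (int t) * inv_qpoch q (int M - int t) * inv_qpoch q (int t + int (Suc c)))"
      by (simp only: mult.assoc)
  qed simp
  also have "S M c + q ^ (Suc M + c) * S M (Suc c)
     = inv_qpoch q (int M) * (inv_qpoch q (int M + int c) + q ^ (Suc M + c) * inv_qpoch q (int (Suc M + c)))"
    by (simp add: S algebra_simps)
  also have "inv_qpoch q (int M + int c) + q ^ (Suc M + c) * inv_qpoch q (int (Suc M + c)) = inv_qpoch q (int (Suc M + c))"
    using inv_qpoch_pred[OF q, of "int (Suc M + c)"] unfolding power_int_of_nat by (simp add: algebra_simps)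
  also have "inv_qpoch q (int M) = (1 - q ^ Suc M) * inv_qpoch q (int (Suc M))"
    using inv_qpoch_pred[OF q, of "int (Suc M)"] unfolding power_int_of_nat by simp
  finally have "(1 - q ^ Suc M) * S (Suc M) c = (1 - q ^ Suc M) * (inv_qpoch q (int (Suc M)) * inv_qpoch q (int (Suc M) + int c))"
    by (simp only: of_nat_add mult.assoc)
  moreover have "1 - q ^ Suc M \<noteq> 0" using power_neq_one[OF q, of M] by simp
  ultimately show ?case unfolding S_def by (simp only: mult_cancel_left simp_thms)
qed

text \<open>
  A nonzero term has $r \<ge> s$ and $r \<ge> -s - a$.  For $a \<le> 1$ one of these bounds is nonnegative, so
  that natural numbers $r$ suffice; for $a = 2$, $s = -1$ the index $r = -1$ would be missing.  The symmetry
  $s \<mapsto> -s - a$ exchanges the two denominators that depend on $s$ and allows to take $s$ as the larger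
  bound; then $r = s + t$ leads to the previous sum with $c = 2s + a$.
\<close>

lemma q_vandermonde_int:
  assumes q: "norm q < 1" "q \<noteq> 0" and a: "a \<le> 1"
  shows "(\<Sum>r\<le>n. q ^ (r\<^sup>2 + a * r) * inv_qpoch q (int n - int r) * inv_qpoch q (int r - s) * inv_qpoch q (int r + s + int a))
    = q powi (s\<^sup>2 + int a * s) * inv_qpoch q (int n - s) * inv_qpoch q (int n + s + int a)"
proof -
  have *: "(\<Sum>r\<le>n. q ^ (r\<^sup>2 + a * r) * inv_qpoch q (int n - int r) * inv_qpoch q (int r - s) * inv_qpoch q (int r + s + int a))
    = q powi (s\<^sup>2 + int a * s) * inv_qpoch q (int n - s) * inv_qpoch q (int n + s + int a)"
    if s: "2 * s + int a \<ge> 0" for s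
  proof -
    have "s \<ge> 0" using s a by linarith
    then obtain u where u: "s = int u" by (rule nonneg_int_cases)
    show ?thesis
    proof (cases "u \<le> n")
      case False
      then show ?thesis by (simp add: u inv_qpoch_neg)
    next
      case True
      have "(\<Sum>r\<le>n. q ^ (r\<^sup>2 + a * r) * inv_qpoch q (int n - int r) * inv_qpoch q (int r - s) * inv_qpoch q (int r + s + int a))
        = (\<Sum>r\<in>{u..n}. q ^ (r\<^sup>2 + a * r) * inv_qpoch q (int n - int r) * inv_qpoch q (int r - s) * inv_qpoch q (int r + s + int a))"
        by (rule sum.mono_neutral_right) (auto simp: u inv_qpoch_neg)
      also have "\<dots> = (\<Sum>t\<le>n-u. q ^ (u\<^sup>2 + a * u) *
          (q ^ (t * (t + (2 * u + a))) * inv_qpoch q (int t) * inv_qpoch q (int (n-u) - int t) * inv_qpoch q (int t + int (2 * u + a))))"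
      proof (rule sum.reindex_bij_witness[of _ "\<lambda>t. t + u" "\<lambda>r. r - u"]; (use True in force)?)
        fix r assume "r \<in> {u..n}"
        then obtain t where t: "r = u + t" by (auto simp: le_iff_add)
        have "q ^ (r\<^sup>2 + a * r) = q ^ (u\<^sup>2 + a * u) * q ^ (t * (t + (2 * u + a)))"
          unfolding power_add[symmetric] by (rule arg_cong[of _ _ "power q"]) (simp add: t algebra_simps power2_eq_square)
        then show "q ^ (u\<^sup>2 + a * u) * (q ^ ((r-u) * ((r-u) + (2 * u + a))) * inv_qpoch q (int (r-u)) * inv_qpoch q (int (n-u) - int (r-u)) * inv_qpoch q (int (r-u) + int (2 * u + a)))
          = q ^ (r\<^sup>2 + a * r) * inv_qpoch q (int n - int r) * inv_qpoch q (int r - s) * inv_qpoch q (int r + s + int a)"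
          using True by (simp add: t u algebra_simps)
      qed
      also have "\<dots> = q ^ (u\<^sup>2 + a * u) * (inv_qpoch q (int (n-u)) * inv_qpoch q (int (n-u) + int (2 * u + a)))"
        unfolding sum_distrib_left[symmetric] q_vandermonde_nat[OF q(1)] ..
      also have "q ^ (u\<^sup>2 + a * u) = q powi (s\<^sup>2 + int a * s)"
        by (simp add: u flip: power_int_of_nat)
      also have "int (n-u) = int n - s" using True by (simp add: u)
      also have "int n - s + int (2 * u + a) = int n + s + int a" by (simp add: u)
      finally show ?thesis by (simp add: mult.assoc)
    qed
  qed
  show ?thesis
  proof (cases "2 * s + int a \<ge> 0")
    case False
    define s' where "s' = - s - int a"
    have "2 * s' + int a \<ge> 0" using False by (simp add: s'_def)
    note * [OF this]
    moreover have "s'\<^sup>2 + int a * s' = s\<^sup>2 + int a * s"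
      by (simp add: s'_def power2_eq_square algebra_simps)
    moreover have "x + s' + int a = x - s" "x - s' = x + s + int a" for x by (auto simp: s'_def)
    ultimately show ?thesis by (simp add: mult_ac)
  qed (rule *)
qed

text \<open>
  Bailey pairs relative to $q^a$, in bilateral form.  For $a = 0$ the classical sequence is
  $\<alpha>_s + \<alpha>_{-s}$ (for $s > 0$), and for $a = 1$ it is $\<alpha>_s + \<alpha>_{-1-s}$ up to the factor $1 - q$.
  Keeping both signs of the index makes the sequences that occur here powers of $q$ up to sign, and the final
  sum over them is the one in the Jacobi triple product.
\<close>

definition bailey_pair :: "complex \<Rightarrow> nat \<Rightarrow> (int \<Rightarrow> complex) \<Rightarrow> (nat \<Rightarrow> complex) \<Rightarrow> bool" where
  "bailey_pair q a \<alpha> \<beta> \<longleftrightarrow>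
     (\<forall>n. \<beta> n = (\<Sum>s = - int (n + a)..int n. \<alpha> s * inv_qpoch q (int n - s) * inv_qpoch q (int n + s + int a)))"

text \<open>
  Bailey's lemma in the limit in which both of its free parameters tend to infinity: after an interchange
  of the two sums the inner one is the $q$-Vandermonde sum.
\<close>

lemma bailey_step:
  assumes q: "norm q < 1" "q \<noteq> 0" and a: "a \<le> 1" and B: "bailey_pair q a \<alpha> \<beta>"
  shows "bailey_pair q a (\<lambda>s. \<alpha> s * q powi (s\<^sup>2 + int a * s))
     (\<lambda>n. \<Sum>r\<le>n. q ^ (r\<^sup>2 + a * r) * inv_qpoch q (int n - int r) * \<beta> r)"
  unfolding bailey_pair_def
proof
  fix n
  have "(\<Sum>r\<le>n. q ^ (r\<^sup>2 + a * r) * inv_qpoch q (int n - int r) * \<beta> r)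
    = (\<Sum>r\<le>n. q ^ (r\<^sup>2 + a * r) * inv_qpoch q (int n - int r) *
        (\<Sum>s = - int (n + a)..int n. \<alpha> s * inv_qpoch q (int r - s) * inv_qpoch q (int r + s + int a)))"
  proof (rule sum.cong)
    fix r assume r: "r \<in> {..n}"
    have "\<beta> r = (\<Sum>s = - int (r + a)..int r. \<alpha> s * inv_qpoch q (int r - s) * inv_qpoch q (int r + s + int a))"
      using B by (simp add: bailey_pair_def)
    also have "\<dots> = (\<Sum>s = - int (n + a)..int n. \<alpha> s * inv_qpoch q (int r - s) * inv_qpoch q (int r + s + int a))"
      using r by (intro sum.mono_neutral_left) (auto simp: inv_qpoch_neg)
    finally show "q ^ (r\<^sup>2 + a * r) * inv_qpoch q (int n - int r) * \<beta> r = q ^ (r\<^sup>2 + a * r) * inv_qpoch q (int n - int r) * \<dots>"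
      by simp
  qed simp
  also have "\<dots> = (\<Sum>s = - int (n + a)..int n. \<alpha> s *
     (\<Sum>r\<le>n. q ^ (r\<^sup>2 + a * r) * inv_qpoch q (int n - int r) * inv_qpoch q (int r - s) * inv_qpoch q (int r + s + int a)))"
    unfolding sum_distrib_left by (subst sum.swap) (simp add: mult_ac)
  also have "\<dots> = (\<Sum>s = - int (n + a)..int n. \<alpha> s * q powi (s\<^sup>2 + int a * s) * inv_qpoch q (int n - s) * inv_qpoch q (int n + s + int a))"
    unfolding q_vandermonde_int[OF q a] by (simp add: mult.assoc)
  finally show "(\<Sum>r\<le>n. q ^ (r\<^sup>2 + a * r) * inv_qpoch q (int n - int r) * \<beta> r) = \<dots>" .
qed

text \<open>
  The seed of the chain: the finite triple product at $x = 1$, where the factor $1 - x$ is zero.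
\<close>

lemma unit_bailey_pair:
  assumes q: "norm q < 1" "q \<noteq> 0"
  shows "bailey_pair q a (\<lambda>s. (-1) powi s * q powi tri s) (\<lambda>n. if n = 0 then 1 else 0)"
  unfolding bailey_pair_def
proof
  fix n
  have "(\<Sum>s = - int (n + a)..int n. (-1) powi s * q powi tri s * inv_qpoch q (int n - s) * inv_qpoch q (int n + s + int a))
    = (\<Sum>s = - int (n + a)..int n. (-1) powi s * q powi tri s * inv_qpoch q (int n - s) * inv_qpoch q (int (n + a) + s))"
    by (simp add: algebra_simps)
  also have "\<dots> = qpoch 1 q n * qpoch q q (n + a) * inv_qpoch q (int n + int (n + a))"
    using finite_triple_product[OF q, where x = 1 and n = n and m = "n + a"] by simp
  also have "\<dots> = (if n = 0 then 1 else 0)"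
  proof (cases n)
    case 0
    then show ?thesis using qpoch_self_nonzero[OF q(1), of a] by (simp add: inv_qpoch_of_nat qpoch_def)
  next
    case (Suc k)
    then have "qpoch 1 q n = 0" unfolding qpoch_def Suc prod.lessThan_Suc_shift by simp
    with Suc show ?thesis by simp
  qed
  finally show "(if n = 0 then 1 else 0) =
     (\<Sum>s = - int (n + a)..int n. (-1) powi s * q powi tri s * inv_qpoch q (int n - s) * inv_qpoch q (int n + s + int a))"
    by simp
qed

text \<open>
  Passing from $a = 1$ to $a = 0$ replaces $1/(q;q)_{n+s+1}$ by
  $1/(q;q)_{n+s} = (1 - q^{n+s+1})/(q;q)_{n+s+1}$.  The hypothesis says that $q^s \<alpha>_s$ is odd under
  the reflection $s \<mapsto> -1 - s$, which fixes the product of denominators; hence the correction term sums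
  to zero.
\<close>

lemma bailey_pair_lower:
  assumes q: "norm q < 1" "q \<noteq> 0" and B: "bailey_pair q 1 \<alpha> \<beta>"
    and anti: "\<And>s. \<alpha> (- 1 - s) = - (q powi (2 * s + 1)) * \<alpha> s"
  shows "bailey_pair q 0 \<alpha> \<beta>"
  unfolding bailey_pair_def
proof
  fix n
  define I where "I = {- int (n + 1)..int n}"
  define d where "d s = \<alpha> s * q powi (int n + s + 1) * inv_qpoch q (int n - s) * inv_qpoch q (int n + s + 1)" for s
  \<comment> \<open>\<open>d\<close> is the correction term; it is odd under the reflection\<close>
  have "sum d I = (\<Sum>s\<in>I. - d s)"
  proof (rule sum.reindex_bij_witness[of _ "\<lambda>s. - 1 - s" "\<lambda>s. - 1 - s"])
    fix s
    have e0: "q powi (2 * s + 1) * q powi (int n - s) = q powi (int n + s + 1)"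
      using q by (simp add: algebra_simps flip: power_int_add)
    have e1: "int n + (- 1 - s) + 1 = int n - s" by simp
    have e2: "int n - (- 1 - s) = int n + s + 1" by simp
    show "- d (- 1 - s) = d s"
      unfolding d_def anti e1 e2 e0[symmetric] by simp
  qed (auto simp: I_def)
  then have d0: "sum d I = 0" by (simp add: sum_negf)
  have "\<beta> n = (\<Sum>s\<in>I. \<alpha> s * inv_qpoch q (int n - s) * inv_qpoch q (int n + s + 1))"
    using B by (simp add: bailey_pair_def I_def)
  also have "\<dots> = (\<Sum>s\<in>I. \<alpha> s * inv_qpoch q (int n - s) * inv_qpoch q (int n + s + 1)) - sum d I"
    using d0 by simp
  also have "\<dots> = (\<Sum>s\<in>I. \<alpha> s * inv_qpoch q (int n - s) * inv_qpoch q (int n + s))"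
    unfolding sum_subtractf[symmetric]
  proof (rule sum.cong)
    fix s
    have e: "inv_qpoch q (int n + s) = (1 - q powi (int n + s + 1)) * inv_qpoch q (int n + s + 1)"
      using inv_qpoch_pred[OF q(1), of "int n + s + 1"] by simp
    show "\<alpha> s * inv_qpoch q (int n - s) * inv_qpoch q (int n + s + 1) - d s = \<alpha> s * inv_qpoch q (int n - s) * inv_qpoch q (int n + s)"
      unfolding d_def e by (simp add: algebra_simps)
  qed simp
  also have "\<dots> = (\<Sum>s = - int (n + 0)..int n. \<alpha> s * inv_qpoch q (int n - s) * inv_qpoch q (int n + s + int 0))"
    unfolding I_def by (rule sum.mono_neutral_cong_right) (auto simp: inv_qpoch_neg)
  finally show "\<beta> n = \<dots>" .
qed

section \<open>Limits of finite sums: the Jacobi triple product and Euler's sum\<close>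
text \<open>
  Tannery's theorem for unordered sums over an arbitrary index type; it is needed over the integers and
  over pairs of naturals.
\<close>

lemma tannery_limit:
  fixes f :: "nat \<Rightarrow> 'b \<Rightarrow> complex"
  assumes lim: "\<And>s. (\<lambda>n. f n s) \<longlonglongrightarrow> h s"
    and bound: "\<And>n s. norm (f n s) \<le> g s" and g: "g summable_on UNIV"
    and sums: "\<And>n. (f n has_sum S n) UNIV"
  shows "h summable_on UNIV" and "S \<longlonglongrightarrow> (\<Sum>\<^sub>\<infinity>s. h s)"
proof -
  have "norm (h s) \<le> g s" for s
    by (rule Lim_bounded[OF tendsto_norm[OF lim], where M = 0]) (use bound in auto)
  then have "(\<lambda>s. norm (h s)) summable_on UNIV"
    by (intro Infinite_Sum.abs_summable_on_comparison_test'[OF g])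
  then show "h summable_on UNIV" by (rule abs_summable_summable)
  then have h: "(h has_sum (\<Sum>\<^sub>\<infinity>s. h s)) UNIV" by simp
  have "uniform_limit UNIV (\<lambda>X n. \<Sum>s\<in>X. f n s) S (finite_subsets_at_top UNIV)"
    using bound sums g by (intro Weierstrass_m_test_general'[where M = g]) auto
  then show "S \<longlonglongrightarrow> (\<Sum>\<^sub>\<infinity>s. h s)"
    using h lim by (intro swap_uniform_limit'[where f = "\<lambda>X n. \<Sum>s\<in>X. f n s"])
      (auto simp: has_sum_def intro!: tendsto_sum always_eventually)
qed

lemma tannery_has_sum:
  fixes f :: "nat \<Rightarrow> 'b \<Rightarrow> complex"
  assumes "\<And>s. (\<lambda>n. f n s) \<longlonglongrightarrow> h s"
    and "\<And>n s. norm (f n s) \<le> g s" and "g summable_on UNIV"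
    and "\<And>n. (f n has_sum S n) UNIV" and S: "S \<longlonglongrightarrow> L"
  shows "(h has_sum L) UNIV"
proof -
  note lim = tannery_limit[OF assms(1-4)]
  have "L = (\<Sum>\<^sub>\<infinity>s. h s)" using LIMSEQ_unique[OF S lim(2)] .
  with lim(1) show ?thesis by simp
qed

text \<open>
  Consecutive terms have the ratio $y r^n$, which tends to $0$.
\<close>

lemma theta_half_summable:
  fixes y r :: real
  assumes "0 < r" "r < 1" "0 < y"
  shows "(\<lambda>n::nat. y powi int n * r powi tri (int n)) summable_on UNIV"
proof -
  define f where "f n = y powi int n * r powi tri (int n)" for n :: nat
  have pos: "f n > 0" for n using assms by (simp add: f_def)
  have "(\<lambda>n. y * r ^ n) \<longlonglongrightarrow> y * 0"
    using assms by (intro tendsto_mult tendsto_const LIMSEQ_realpow_zero) auto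
  then have "\<forall>\<^sub>F n in sequentially. y * r ^ n < 1/2"
    by (rule order_tendstoD) auto
  then obtain N where N: "\<And>n. n \<ge> N \<Longrightarrow> y * r ^ n < 1/2"
    by (auto simp: eventually_sequentially)
  have step: "f (Suc n) = y * r ^ n * f n" for n
  proof -
    have "int (Suc n) = int n + 1" by simp
    then show ?thesis unfolding f_def
      using assms by (simp only: tri_add_one) (simp add: power_int_add)
  qed
  have "summable f"
  proof (rule summable_ratio_test)
    fix n assume "n \<ge> N"
    then have "f (Suc n) \<le> 1/2 * f n"
      unfolding step using N pos by (intro mult_right_mono) (auto simp: less_imp_le)
    then show "norm (f (Suc n)) \<le> 1/2 * norm (f n)"
      using pos[of n] pos[of "Suc n"] by simp
  qed simp
  then show ?thesis
    unfolding f_def[symmetric] using pos by (intro norm_summable_imp_summable_on) (simp add: less_imp_le)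
qed

lemma theta_summable:
  fixes y r :: real
  assumes r: "0 < r" "r < 1" and y: "0 < y"
  shows "(\<lambda>s::int. y powi s * r powi tri s) summable_on UNIV"
proof -
  let ?f = "\<lambda>s::int. y powi s * r powi tri s"
  have "?f summable_on range int"
    using theta_half_summable[OF r y] by (subst summable_on_reindex) (auto simp: o_def)
  moreover have "?f summable_on range (\<lambda>n. - int n)"
  proof -
    have "?f (- int n) = (r / y) powi int n * r powi tri (int n)" for n
    proof -
      have "tri (- int n) = int n + tri (int n)"
        using two_tri[of "int n"] two_tri[of "- int n"] by (simp add: algebra_simps)
      then show ?thesis using r y
        by (simp add: power_int_add power_int_minus divide_inverse power_mult_distrib power_inverse)
    qed
    then show ?thesis
      using theta_half_summable[OF r, of "r / y"] r y
      by (subst summable_on_reindex) (auto simp: o_def inj_on_def)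
  qed
  ultimately have "?f summable_on (range int \<union> range (\<lambda>n. - int n))"
    by (rule summable_on_union)
  moreover have "range int \<union> range (\<lambda>n. - int n) = UNIV"
  proof (intro UNIV_eq_I[symmetric])
    show "s \<in> range int \<union> range (\<lambda>n. - int n)" for s
      by (cases s rule: int_cases2) auto
  qed
  ultimately show ?thesis by simp
qed

lemma norm_mult_le:
  fixes x y :: complex
  assumes "norm x \<le> X" "norm y \<le> Y"
  shows "norm (x * y) \<le> X * Y"
proof -
  have "0 \<le> X" using assms norm_ge_zero order_trans by blast
  with assms show ?thesis unfolding norm_mult by (intro mult_mono) auto
qed

text \<open>
  The limit of the symmetric case $n = m$ of the finite triple product.  The bounded factors
  $1/(q;q)_{n \<mp> s}$ both tend to $1/(q;q)_\<infinity>$, and the theta series dominates.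
\<close>

theorem jacobi_triple_product:
  assumes q: "norm q < 1" "q \<noteq> 0" and x: "x \<noteq> 0"
  shows "((\<lambda>s. (-x) powi s * q powi tri s) has_sum
     (qpoch_inf x q * qpoch_inf (q / x) q * qpoch_inf q q)) UNIV"
proof -
  obtain C where C: "\<And>m. norm (inv_qpoch q m) \<le> C" using inv_qpoch_bounded[OF q(1)] by blast
  let ?t = "\<lambda>s. (-x) powi s * q powi tri s" and ?P = "qpoch_inf q q"
  have "((\<lambda>s. ?t s * inverse ?P * inverse ?P) has_sum
     (qpoch_inf x q * qpoch_inf (q / x) q * inverse ?P)) UNIV"
  proof (rule tannery_has_sum)
    show "(\<lambda>n. ?t s * inv_qpoch q (int n - s) * inv_qpoch q (int n + s)) \<longlonglongrightarrow> ?t s * inverse ?P * inverse ?P" for s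
      using inv_qpoch_tendsto[OF q(1), of "-s"] inv_qpoch_tendsto[OF q(1), of s]
      by (intro tendsto_mult tendsto_const) auto
    show "norm (?t s * inv_qpoch q (int n - s) * inv_qpoch q (int n + s)) \<le> norm x powi s * norm q powi tri s * C * C" for n s
      by (intro norm_mult_le C) (simp_all add: norm_power_int)
    show "(\<lambda>s. norm x powi s * norm q powi tri s * C * C) summable_on UNIV"
      using theta_summable[of "norm q" "norm x"] q x by (intro summable_on_cmult_left) auto
    show "((\<lambda>s. ?t s * inv_qpoch q (int n - s) * inv_qpoch q (int n + s)) has_sum
       (qpoch x q n * qpoch (q / x) q n * inv_qpoch q (int n + int n))) UNIV" for n
      by (rule has_sum_finite_neutralI[of "{- int n..int n}"])
        (auto simp: inv_qpoch_neg finite_triple_product[OF q x])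
    have "(\<lambda>n. inv_qpoch q (int n + int n)) \<longlonglongrightarrow> inverse ?P"
    proof -
      have "(\<lambda>n. inv_qpoch q (int n + int n)) = (\<lambda>n. inv_qpoch q (int n + 0)) \<circ> (\<lambda>n. n + n)"
        by (simp add: o_def)
      then show ?thesis
        by (simp only:) (intro LIMSEQ_subseq_LIMSEQ inv_qpoch_tendsto q, simp add: strict_mono_def)
    qed
    then show "(\<lambda>n. qpoch x q n * qpoch (q / x) q n * inv_qpoch q (int n + int n)) \<longlonglongrightarrow> qpoch_inf x q * qpoch_inf (q / x) q * inverse ?P"
      by (intro tendsto_mult qpoch_tendsto q)
  qed
  from has_sum_cmult_right[OF this, of "?P * ?P"]
  have "((\<lambda>s. (?P * inverse ?P) * (?P * inverse ?P) * ?t s) has_sum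
     (?P * inverse ?P) * (qpoch_inf x q * qpoch_inf (q / x) q * ?P)) UNIV"
    by (simp only: mult_ac)
  moreover have "?P * inverse ?P = 1" using qpoch_inf_self_nonzero[OF q(1)] by (rule right_inverse)
  ultimately show ?thesis by (simp only: mult_1_left)
qed

text \<open>
  The limit $n \<rightarrow> \<infinity>$ of the finite triple product with $m = 0$, where the factor $1/(q;q)_s$ makes the
  sum one-sided.
\<close>

lemma euler_sum:
  assumes q: "norm q < 1" "q \<noteq> 0" and x: "x \<noteq> 0"
  shows "((\<lambda>i. (-x) ^ i * q powi tri (int i) / qpoch q q i) has_sum qpoch_inf x q) UNIV"
proof -
  obtain C where C: "\<And>m. norm (inv_qpoch q m) \<le> C" using inv_qpoch_bounded[OF q(1)] by blast
  let ?t = "\<lambda>s. (-x) powi s * q powi tri s" and ?P = "qpoch_inf q q"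
  have "((\<lambda>s. ?t s * inverse ?P * inv_qpoch q s) has_sum (qpoch_inf x q * inverse ?P)) UNIV"
  proof (rule tannery_has_sum)
    show "(\<lambda>n. ?t s * inv_qpoch q (int n - s) * inv_qpoch q s) \<longlonglongrightarrow> ?t s * inverse ?P * inv_qpoch q s" for s
      using inv_qpoch_tendsto[OF q(1), of "-s"]
      by (intro tendsto_mult tendsto_const) auto
    show "norm (?t s * inv_qpoch q (int n - s) * inv_qpoch q s) \<le> norm x powi s * norm q powi tri s * C * C" for n s
      by (intro norm_mult_le C) (simp_all add: norm_power_int)
    show "(\<lambda>s. norm x powi s * norm q powi tri s * C * C) summable_on UNIV"
      using theta_summable[of "norm q" "norm x"] q x by (intro summable_on_cmult_left) auto
    show "((\<lambda>s. ?t s * inv_qpoch q (int n - s) * inv_qpoch q s) has_sum (qpoch x q n * inv_qpoch q (int n + 0))) UNIV" for n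
      using finite_triple_product[OF q x, where n = n and m = 0]
      by (intro has_sum_finite_neutralI[of "{0..int n}"]) (auto simp: inv_qpoch_neg qpoch_def)
    show "(\<lambda>n. qpoch x q n * inv_qpoch q (int n + 0)) \<longlonglongrightarrow> qpoch_inf x q * inverse ?P"
      by (intro tendsto_mult qpoch_tendsto inv_qpoch_tendsto q)
  qed
  from has_sum_cmult_right[OF this, of "?P"]
  have "((\<lambda>s. (?P * inverse ?P) * (?t s * inv_qpoch q s)) has_sum (?P * inverse ?P) * qpoch_inf x q) UNIV"
    by (simp only: mult_ac)
  moreover have "?P * inverse ?P = 1" using qpoch_inf_self_nonzero[OF q(1)] by (rule right_inverse)
  ultimately have sum_int: "((\<lambda>s. ?t s * inv_qpoch q s) has_sum qpoch_inf x q) UNIV"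
    by (simp only: mult_1_left)
  have "((\<lambda>s. ?t s * inv_qpoch q s) has_sum qpoch_inf x q) (range int)"
  proof (rule has_sum_cong_neutral[THEN iffD1, OF _ _ _ sum_int])
    fix s :: int assume "s \<in> UNIV - range int"
    then have "s < 0" by (cases s rule: int_cases) auto
    then show "?t s * inv_qpoch q s = 0" by (simp add: inv_qpoch_neg)
  qed auto
  then have "((\<lambda>s. ?t s * inv_qpoch q s) \<circ> int has_sum qpoch_inf x q) UNIV"
    by (subst (asm) has_sum_reindex) auto
  then show ?thesis
    by (simp add: o_def inv_qpoch_of_nat divide_inverse)
qed

section \<open>The Andrews-Gordon identities modulo 7\<close>
text \<open>
  This evaluates the limit of the last member of a Bailey chain: in the defining sum of $\<beta>_n$ both
  denominators tend to $(q;q)_\<infinity>$.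
\<close>

lemma bailey_limit:
  assumes q: "norm q < 1" and B: "bailey_pair q a \<alpha> \<beta>"
    and abs: "(\<lambda>s. norm (\<alpha> s)) summable_on UNIV" and L: "(\<alpha> has_sum L) UNIV"
  shows "\<beta> \<longlonglongrightarrow> L * inverse (qpoch_inf q q) * inverse (qpoch_inf q q)"
proof -
  obtain C where C: "\<And>m. norm (inv_qpoch q m) \<le> C" using inv_qpoch_bounded[OF q] by blast
  let ?P = "qpoch_inf q q"
  have "\<beta> \<longlonglongrightarrow> (\<Sum>\<^sub>\<infinity>s. \<alpha> s * inverse ?P * inverse ?P)"
  proof (rule tannery_limit(2))
    show "(\<lambda>n. \<alpha> s * inv_qpoch q (int n - s) * inv_qpoch q (int n + s + int a)) \<longlonglongrightarrow> \<alpha> s * inverse ?P * inverse ?P" for s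
      using inv_qpoch_tendsto[OF q, of "-s"] inv_qpoch_tendsto[OF q, of "s + int a"]
      by (intro tendsto_mult tendsto_const) (auto simp: add.assoc)
    show "norm (\<alpha> s * inv_qpoch q (int n - s) * inv_qpoch q (int n + s + int a)) \<le> norm (\<alpha> s) * C * C" for n s
      by (intro norm_mult_le C order_refl)
    show "(\<lambda>s. norm (\<alpha> s) * C * C) summable_on UNIV"
      using abs by (intro summable_on_cmult_left)
    show "((\<lambda>s. \<alpha> s * inv_qpoch q (int n - s) * inv_qpoch q (int n + s + int a)) has_sum \<beta> n) UNIV" for n
      using B by (intro has_sum_finite_neutralI[of "{- int (n + a)..int n}"])
        (auto simp: inv_qpoch_neg bailey_pair_def)
  qed
  also have "(\<Sum>\<^sub>\<infinity>s. \<alpha> s * inverse ?P * inverse ?P) = L * inverse ?P * inverse ?P"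
    by (intro infsumI has_sum_cmult_left L)
  finally show ?thesis .
qed

text \<open>
  Two steps from the unit pair.  The first collapses to $\<beta>_n = 1/(q;q)_n$ because only $r = 0$ contributes.
\<close>

lemma bailey_pair_two_steps:
  assumes q: "norm q < 1" "q \<noteq> 0" and a: "a \<le> 1"
  shows "bailey_pair q a (\<lambda>s. (-1) powi s * q powi (tri s + 2 * (s\<^sup>2 + int a * s)))
    (\<lambda>n. \<Sum>k\<le>n. q ^ (k\<^sup>2 + a * k) * inv_qpoch q (int n - int k) * inv_qpoch q (int k))"
proof -
  have "(\<Sum>r\<le>n. q ^ (r\<^sup>2 + a * r) * inv_qpoch q (int n - int r) * (if r = 0 then 1 else 0)) = inv_qpoch q (int n)" for n
    by (subst sum.remove[of _ 0]) auto
  with bailey_step[OF q a unit_bailey_pair[OF q]]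
  have "bailey_pair q a (\<lambda>s. (-1) powi s * q powi tri s * q powi (s\<^sup>2 + int a * s)) (\<lambda>n. inv_qpoch q (int n))"
    by simp
  from bailey_step[OF q a this] show ?thesis
    using q by (simp only: power_int_add mult_2 mult.assoc simp_thms)
qed

text \<open>
  Besides $c = a$, the only case is $a = 1$, $c = 0$: two steps with linear exponents, followed by the
  passage to $a = 0$ so that the next step may add a purely quadratic exponent.
\<close>

lemma bailey_pair_two_steps_lowered:
  assumes q: "norm q < 1" "q \<noteq> 0" and c: "c \<le> a" and a: "a \<le> 1"
  shows "bailey_pair q c (\<lambda>s. (-1) powi s * q powi (tri s + 2 * (s\<^sup>2 + int a * s)))
    (\<lambda>n. \<Sum>k\<le>n. q ^ (k\<^sup>2 + a * k) * inv_qpoch q (int n - int k) * inv_qpoch q (int k))"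
proof (cases "c = a")
  case True
  then show ?thesis using bailey_pair_two_steps[OF q a] by simp
next
  case False
  with c a have ac: "a = 1" "c = 0" by auto
  show ?thesis unfolding ac(2)
  proof (rule bailey_pair_lower[OF q])
    show "bailey_pair q 1 (\<lambda>s. (-1) powi s * q powi (tri s + 2 * (s\<^sup>2 + int a * s)))
      (\<lambda>n. \<Sum>k\<le>n. q ^ (k\<^sup>2 + a * k) * inv_qpoch q (int n - int k) * inv_qpoch q (int k))"
      using bailey_pair_two_steps[OF q a] ac by simp
    fix s :: int
    have "tri (- 1 - s) = tri s + (2 * s + 1)"
      using two_tri[of "- 1 - s"] two_tri[of s] by (simp add: algebra_simps)
    moreover have "(- 1 - s)\<^sup>2 + int a * (- 1 - s) = s\<^sup>2 + int a * s"
      by (simp add: ac power2_eq_square algebra_simps)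
    moreover have "(-1) powi (- 1 - s) = - ((-1 :: complex) powi s)"
      by (cases "even s") auto
    ultimately show "(-1) powi (- 1 - s) * q powi (tri (- 1 - s) + 2 * ((- 1 - s)\<^sup>2 + int a * (- 1 - s))) =
      - (q powi (2 * s + 1)) * ((-1) powi s * q powi (tri s + 2 * (s\<^sup>2 + int a * s)))"
      using q by (simp only:) (simp add: power_int_add mult_ac)
  qed
qed

lemma geometric_has_sum:
  fixes r :: real
  assumes "0 \<le> r" "r < 1"
  shows "((\<lambda>n. r ^ n) has_sum (1 / (1 - r))) UNIV"
  using geometric_sums[of r] assms by (intro sums_nonneg_imp_has_sum) auto

lemma geometric_pair_summable:
  fixes r :: real
  assumes "0 \<le> r" "r < 1"
  shows "(\<lambda>(j, k). r ^ j * r ^ k) summable_on (UNIV :: (nat \<times> nat) set)"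
proof -
  note g = geometric_has_sum[OF assms]
  have "(\<lambda>(j, k). r ^ j * r ^ k) summable_on (UNIV :: nat set) \<times> (UNIV :: nat set)"
  proof (rule summable_on_SigmaI)
    show "((\<lambda>k. (\<lambda>(j, k). r ^ j * r ^ k) (j, k)) has_sum (r ^ j * (1 / (1 - r)))) UNIV" for j
      using has_sum_cmult_right[OF g, of "r ^ j"] by simp
    show "(\<lambda>j. r ^ j * (1 / (1 - r))) summable_on UNIV"
      using g by (intro summable_on_cmult_left) (auto simp: summable_on_def)
  qed (use assms in auto)
  then show ?thesis by simp
qed

lemma geometric_triple_summable:
  fixes r :: real
  assumes "0 \<le> r" "r < 1"
  shows "(\<lambda>((j, k), i). r ^ j * r ^ k * r ^ i) summable_on (UNIV :: ((nat \<times> nat) \<times> nat) set)"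
proof -
  note g = geometric_has_sum[OF assms]
  have "(\<lambda>((j, k), i). r ^ j * r ^ k * r ^ i) summable_on (UNIV :: (nat \<times> nat) set) \<times> (UNIV :: nat set)"
  proof (rule summable_on_SigmaI)
    show "((\<lambda>i. (\<lambda>((j, k), i). r ^ j * r ^ k * r ^ i) (p, i)) has_sum ((case p of (j, k) \<Rightarrow> r ^ j * r ^ k) * (1 / (1 - r)))) UNIV" for p
      using has_sum_cmult_right[OF g, of "case p of (j, k) \<Rightarrow> r ^ j * r ^ k"] by (cases p) simp
    show "(\<lambda>p. (case p of (j, k) \<Rightarrow> r ^ j * r ^ k) * (1 / (1 - r))) summable_on UNIV"
      by (intro summable_on_cmult_left geometric_pair_summable assms)
  qed (use assms in auto)
  then show ?thesis by simp
qed

text \<open>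
  A third step of the chain is taken and $n \<rightarrow> \<infinity>$.  On the $\<beta>$ side the outer index is $r = j + k$, so that
  $1/(q;q)_{r-k}$ becomes $1/(q;q)_j$.  On the $\<alpha>$ side the exponent is
  $t + 2(s^2 + as) + (s^2 + cs) = 7t + (3 + 2a + c)s$ with $t = s(s-1)/2$, a theta series of base $q^7$
  that the Jacobi triple product evaluates.
\<close>

theorem andrews_gordon_mod_7:
  assumes q: "norm q < 1" "q \<noteq> 0" and c: "c \<le> a" and a: "a \<le> 1"
  shows "((\<lambda>(j, k). q ^ ((j + k)\<^sup>2 + c * (j + k) + k\<^sup>2 + a * k) / (qpoch q q j * qpoch q q k)) has_sum
    (qpoch_inf (q ^ (3 + 2 * a + c)) (q ^ 7) * qpoch_inf (q ^ (4 - 2 * a - c)) (q ^ 7) * qpoch_inf (q ^ 7) (q ^ 7)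
      / qpoch_inf q q)) UNIV"
proof -
  obtain C where C: "\<And>m. norm (inv_qpoch q m) \<le> C" using inv_qpoch_bounded[OF q(1)] by blast
  let ?P = "qpoch_inf q q"
  define m where "m = 3 + 2 * a + c"
  define \<alpha> where "\<alpha> s = (- (q ^ m)) powi s * (q ^ 7) powi tri s" for s
  define \<beta> where "\<beta> n = (\<Sum>r\<le>n. q ^ (r\<^sup>2 + c * r) * inv_qpoch q (int n - int r) *
    (\<Sum>k\<le>r. q ^ (k\<^sup>2 + a * k) * inv_qpoch q (int r - int k) * inv_qpoch q (int k)))" for n
  define L where "L = qpoch_inf (q ^ m) (q ^ 7) * qpoch_inf (q ^ (7 - m)) (q ^ 7) * qpoch_inf (q ^ 7) (q ^ 7)"
  have q7: "norm (q ^ 7) < 1" "q ^ 7 \<noteq> 0"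
    using norm_power_less_one[OF q(1)] q(2) by simp_all
  have \<alpha>: "(\<lambda>s. (-1) powi s * q powi (tri s + 2 * (s\<^sup>2 + int a * s)) * q powi (s\<^sup>2 + int c * s)) = \<alpha>"
  proof
    fix s
    have e1: "tri s + 2 * (s\<^sup>2 + int a * s) + (s\<^sup>2 + int c * s) = int m * s + 7 * tri s"
      using two_tri[of s] by (simp add: m_def power2_eq_square algebra_simps)
    have e2: "(- (q ^ m)) powi s = (-1) powi s * q powi (int m * s)"
      using power_int_mult_distrib[of "-1" "q ^ m" s] by (simp add: power_int_mult)
    have e3: "(q ^ 7) powi tri s = q powi (7 * tri s)"
      using power_int_mult[of q 7 "tri s"] by simp
    have pw: "q powi i * q powi j = q powi (i + j)" for i j
      using q by (simp add: power_int_add)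
    show "(-1) powi s * q powi (tri s + 2 * (s\<^sup>2 + int a * s)) * q powi (s\<^sup>2 + int c * s) = \<alpha> s"
      unfolding \<alpha>_def by (simp only: mult.assoc pw e1 e2 e3)
  qed
  have \<beta>: "(\<lambda>n. \<Sum>r\<le>n. q ^ (r\<^sup>2 + c * r) * inv_qpoch q (int n - int r) *
    (\<Sum>k\<le>r. q ^ (k\<^sup>2 + a * k) * inv_qpoch q (int r - int k) * inv_qpoch q (int k))) = \<beta>"
    unfolding \<beta>_def ..
  have B: "bailey_pair q c \<alpha> \<beta>"
    using bailey_step[OF q order_trans[OF c a] bailey_pair_two_steps_lowered[OF q c a]]
    unfolding \<alpha> \<beta> .
  have qm: "q ^ m \<noteq> 0" using q by simp
  have "m \<le> 7" using a c by (simp add: m_def)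
  then have quot: "q ^ 7 / q ^ m = q ^ (7 - m)"
    using q(2) by (metis power_diff)
  have L: "(\<alpha> has_sum L) UNIV"
    using jacobi_triple_product[OF q7 qm] unfolding \<alpha>_def[abs_def] L_def quot .
  have "(\<lambda>s. norm (\<alpha> s)) summable_on UNIV"
    unfolding \<alpha>_def norm_mult norm_power_int norm_minus_cancel
    by (rule theta_summable) (simp_all only: zero_less_norm_iff q7 qm not_False_eq_True)
  from bailey_limit[OF q(1) B this L]
  have lim: "\<beta> \<longlonglongrightarrow> L * inverse ?P * inverse ?P" .
  let ?e = "\<lambda>j k. (j + k)\<^sup>2 + c * (j + k) + k\<^sup>2 + a * k"
  let ?F = "\<lambda>x (j, k). q ^ ?e j k * inv_qpoch q (int j) * inv_qpoch q (int k) * x j k"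
  have "(?F (\<lambda>_ _. inverse ?P) has_sum (L * inverse ?P * inverse ?P)) UNIV"
  proof (rule tannery_has_sum[OF _ _ _ _ lim])
    show "(\<lambda>n. ?F (\<lambda>j k. inv_qpoch q (int n + (- int j - int k))) p) \<longlonglongrightarrow> ?F (\<lambda>_ _. inverse ?P) p" for p
    proof (cases p)
      case (Pair j k)
      show ?thesis unfolding Pair prod.case
        by (intro tendsto_mult tendsto_const inv_qpoch_tendsto q)
    qed
    show "(\<lambda>p. (case p of (j, k) \<Rightarrow> norm q ^ j * norm q ^ k) * C * C * C) summable_on UNIV"
      using q by (intro summable_on_cmult_left geometric_pair_summable) auto
    show "norm (?F (\<lambda>j k. inv_qpoch q (int n + (- int j - int k))) p)
       \<le> (case p of (j, k) \<Rightarrow> norm q ^ j * norm q ^ k) * C * C * C" for n p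
    proof (cases p)
      case (Pair j k)
      have "j + k \<le> (j + k)\<^sup>2" by (simp add: power2_eq_square)
      then have "norm q ^ ?e j k \<le> norm q ^ (j + k)"
        using q by (intro power_decreasing) auto
      then have "norm (q ^ ?e j k) \<le> norm q ^ j * norm q ^ k"
        by (simp only: norm_power power_add[of _ j k])
      then show ?thesis
        unfolding Pair prod.case by (intro norm_mult_le C)
    qed
    show "(?F (\<lambda>j k. inv_qpoch q (int n + (- int j - int k))) has_sum \<beta> n) UNIV" for n
    proof (rule has_sum_finite_neutralI[of "{(j, k). j + k \<le> n}"])
      show "finite {(j, k). j + k \<le> n}"
        by (rule finite_subset[of _ "{..n} \<times> {..n}"]) auto
      show "?F (\<lambda>j k. inv_qpoch q (int n + (- int j - int k))) p = 0" if "p \<in> UNIV - {(j, k). j + k \<le> n}" for p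
      proof (cases p)
        case (Pair j k)
        with that have "int n + (- int j - int k) < 0" by auto
        then show ?thesis unfolding Pair prod.case by (simp only: inv_qpoch_neg mult_zero_right)
      qed
      have "\<beta> n = (\<Sum>(r, k)\<in>Sigma {..n} (\<lambda>r. {..r}). q ^ (r\<^sup>2 + c * r) * inv_qpoch q (int n - int r) *
         (q ^ (k\<^sup>2 + a * k) * inv_qpoch q (int r - int k) * inv_qpoch q (int k)))"
        unfolding \<beta>_def sum_distrib_left by (rule sum.Sigma) auto
      also have "\<dots> = (\<Sum>p\<in>{(j, k). j + k \<le> n}. ?F (\<lambda>j k. inv_qpoch q (int n + (- int j - int k))) p)"
      proof (rule sum.reindex_bij_witness[of _ "\<lambda>(j, k). (j + k, k)" "\<lambda>(r, k). (r - k, k)"])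
        fix p assume "p \<in> Sigma {..n} (\<lambda>r. {..r})"
        then obtain j k where p: "p = (j + k, k)"
          by (cases p) (metis SigmaD2 atMost_iff le_add_diff_inverse2)
        have "int (j + k) - int k = int j" "int n - int (j + k) = int n + (- int j - int k)" by auto
        then show "?F (\<lambda>j k. inv_qpoch q (int n + (- int j - int k))) (case p of (r, k) \<Rightarrow> (r - k, k)) =
          (case p of (r, k) \<Rightarrow> q ^ (r\<^sup>2 + c * r) * inv_qpoch q (int n - int r) *
            (q ^ (k\<^sup>2 + a * k) * inv_qpoch q (int r - int k) * inv_qpoch q (int k)))"
          unfolding p prod.case diff_add_inverse2 add.assoc[of _ "k\<^sup>2"] power_add[of _ _ "k\<^sup>2 + a * k"]
          by (simp only: mult_ac)
      qed auto
      finally show "\<beta> n = \<dots>" .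
    qed simp
  qed
  from has_sum_cmult_right[OF this, of ?P]
  have "((\<lambda>p. (?P * inverse ?P) * (case p of (j, k) \<Rightarrow> q ^ ?e j k * inv_qpoch q (int j) * inv_qpoch q (int k))) has_sum
     (?P * inverse ?P) * (L * inverse ?P)) UNIV"
    by (simp add: mult_ac case_prod_unfold)
  moreover have "?P * inverse ?P = 1" using qpoch_inf_self_nonzero[OF q(1)] by (rule right_inverse)
  ultimately have "((\<lambda>p. case p of (j, k) \<Rightarrow> q ^ ?e j k * inv_qpoch q (int j) * inv_qpoch q (int k)) has_sum L * inverse ?P) UNIV"
    by (simp only: mult_1_left)
  moreover have "7 - m = 4 - 2 * a - c" by (simp add: m_def)
  ultimately show ?thesis
    unfolding L_def m_def by (simp add: inv_qpoch_of_nat divide_inverse mult.assoc)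
qed

section \<open>The triple sums\<close>
lemma qpoch_inf_shift:
  assumes q: "norm q < 1"
  shows "qpoch a q j * qpoch_inf (a * q ^ j) q = qpoch_inf a q"
proof -
  have "qpoch a q (n + j) = qpoch a q j * qpoch (a * q ^ j) q n" for n
    by (induction n) (simp_all add: qpoch_Suc power_add qpoch_def[of _ _ 0] mult_ac)
  then have "(\<lambda>n. qpoch a q j * qpoch (a * q ^ j) q n) \<longlonglongrightarrow> qpoch_inf a q"
    using LIMSEQ_ignore_initial_segment[OF qpoch_tendsto[OF q], of a j] by simp
  moreover have "(\<lambda>n. qpoch a q j * qpoch (a * q ^ j) q n) \<longlonglongrightarrow> qpoch a q j * qpoch_inf (a * q ^ j) q"
    by (intro tendsto_mult tendsto_const qpoch_tendsto q)
  ultimately show ?thesis by (rule LIMSEQ_unique[symmetric])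
qed

lemma qpoch_mult_neg: "qpoch q q n * qpoch (- q) q n = qpoch (q\<^sup>2) (q\<^sup>2) n"
  unfolding qpoch_def prod.distrib[symmetric]
  by (rule prod.cong) (simp_all add: algebra_simps power2_eq_square)

lemma qpoch_inf_mult_neg:
  assumes q: "norm q < 1"
  shows "qpoch_inf q q * qpoch_inf (- q) q = qpoch_inf (q\<^sup>2) (q\<^sup>2)"
proof -
  have "norm (q\<^sup>2) < 1" using norm_power_less_one[OF q] by simp
  then have "(\<lambda>n. qpoch q q n * qpoch (- q) q n) \<longlonglongrightarrow> qpoch_inf (q\<^sup>2) (q\<^sup>2)"
    unfolding qpoch_mult_neg by (rule qpoch_tendsto)
  moreover have "(\<lambda>n. qpoch q q n * qpoch (- q) q n) \<longlonglongrightarrow> qpoch_inf q q * qpoch_inf (- q) q"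
    by (intro tendsto_mult qpoch_tendsto q)
  ultimately show ?thesis by (rule LIMSEQ_unique[symmetric])
qed

text \<open>
  Summing over $i$ gives $(-q^{j+1};q)_\<infinity>$.  The quotient form separates a constant from a factor that turns
  $(q;q)_j$ into $(q^2;q^2)_j$.
\<close>

lemma euler_sum_shifted:
  assumes q: "norm q < 1" "q \<noteq> 0"
  shows "((\<lambda>i. q ^ ((i\<^sup>2 + i) div 2 + i * j) / qpoch q q i) has_sum (qpoch_inf (- q) q / qpoch (- q) q j)) UNIV"
proof -
  have q2: "norm (q\<^sup>2) < 1" using norm_power_less_one[OF q(1)] by simp
  have nz: "qpoch (- q) q j \<noteq> 0"
    using qpoch_mult_neg[of q j] qpoch_self_nonzero[OF q2, of j] by auto
  have "(- (- q * q ^ j)) ^ i * q powi tri (int i) = q ^ ((i\<^sup>2 + i) div 2 + i * j)" for i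
  proof -
    have "2 * tri (int i) + 2 * int i = int (i\<^sup>2 + i)"
      using two_tri[of "int i"] by (simp add: power2_eq_square algebra_simps)
    then have e: "int ((i\<^sup>2 + i) div 2) = tri (int i) + int i"
      by (simp add: zdiv_int)
    have "(- (- q * q ^ j)) ^ i = q ^ (i + i * j)"
      by (simp add: power_mult_distrib power_add mult.commute flip: power_mult)
    moreover have "q ^ (i + i * j) * q powi tri (int i) = q powi (int (i + i * j) + tri (int i))"
      using q by (simp only: power_int_add power_int_of_nat simp_thms)
    moreover have "int (i + i * j) + tri (int i) = int ((i\<^sup>2 + i) div 2 + i * j)"
      unfolding of_nat_add e by simp
    ultimately show ?thesis by (simp only: power_int_of_nat)
  qed
  with euler_sum[OF q, of "- q * q ^ j"] q
  have "((\<lambda>i. q ^ ((i\<^sup>2 + i) div 2 + i * j) / qpoch q q i) has_sum qpoch_inf (- q * q ^ j) q) UNIV"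
    by simp
  moreover have "qpoch_inf (- q * q ^ j) q = qpoch_inf (- q) q / qpoch (- q) q j"
    using qpoch_inf_shift[OF q(1), of "- q" j] nz by (simp add: field_simps)
  ultimately show ?thesis by simp
qed

text \<open>
  The inner sum over $i$ leaves $(-q;q)_\<infinity>$ times the double sum of the Andrews-Gordon identity with base
  $Q = q^2$, because $2j^2 + 4k^2 + 4jk = 2((j + k)^2 + k^2)$.  The product $(-q;q)_\<infinity>$ then cancels
  $(Q;Q)_\<infinity> = (q;q)_\<infinity>(-q;q)_\<infinity>$ down to $(q;q)_\<infinity>$.
\<close>

lemma triple_sum:
  assumes q: "norm q < 1" "q \<noteq> 0" and c: "c \<le> a" and a: "a \<le> 1"
  shows "((\<lambda>(i, j, k). q ^ ((i\<^sup>2 + i) div 2 + 2 * j\<^sup>2 + 4 * k\<^sup>2 + i * j + 4 * j * k + 2 * c * (j + k) + 2 * a * k)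
              / (qpoch q q i * qpoch q q j * qpoch (q\<^sup>2) (q\<^sup>2) k))
     has_sum (qpoch_inf_list [q ^ (6 + 4 * a + 2 * c), q ^ (8 - 4 * a - 2 * c), q ^ 14] (q ^ 14) / qpoch_inf q q)) UNIV"
proof -
  define Q where "Q = q\<^sup>2"
  have Q: "norm Q < 1" "Q \<noteq> 0"
    using norm_power_less_one[OF q(1)] q(2) by (simp_all add: Q_def)
  obtain C where C: "\<And>m. norm (inv_qpoch q m) \<le> C" using inv_qpoch_bounded[OF q(1)] by blast
  obtain D where D: "\<And>m. norm (inv_qpoch Q m) \<le> D" using inv_qpoch_bounded[OF Q(1)] by blast
  let ?e = "\<lambda>j k. (j + k)\<^sup>2 + c * (j + k) + k\<^sup>2 + a * k"
  let ?E = "\<lambda>i j k. (i\<^sup>2 + i) div 2 + 2 * j\<^sup>2 + 4 * k\<^sup>2 + i * j + 4 * j * k + 2 * c * (j + k) + 2 * a * k"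
  let ?f = "\<lambda>((j, k), i). q ^ ?E i j k * inv_qpoch q (int i) * inv_qpoch q (int j) * inv_qpoch Q (int k)"
  let ?N = "qpoch_inf (- q) q"
  define A where "A = qpoch_inf (Q ^ (3 + 2 * a + c)) (Q ^ 7) * qpoch_inf (Q ^ (4 - 2 * a - c)) (Q ^ 7) * qpoch_inf (Q ^ 7) (Q ^ 7)"
  have "(?f has_sum (?N * (A / qpoch_inf Q Q))) (UNIV \<times> UNIV)"
  proof (rule has_sum_SigmaI)
    show "((\<lambda>p. ?N * (case p of (j, k) \<Rightarrow> Q ^ ?e j k / (qpoch Q Q j * qpoch Q Q k))) has_sum (?N * (A / qpoch_inf Q Q))) UNIV"
      unfolding A_def by (intro has_sum_cmult_right andrews_gordon_mod_7 Q c a)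
    show "((\<lambda>i. ?f (p, i)) has_sum (?N * (case p of (j, k) \<Rightarrow> Q ^ ?e j k / (qpoch Q Q j * qpoch Q Q k)))) UNIV" for p
    proof (cases p)
      case (Pair j k)
      \<comment> \<open>the part of the exponent that contains \<open>i\<close> is split from the Andrews-Gordon exponent\<close>
      have E: "?E i j k = ((i\<^sup>2 + i) div 2 + i * j) + 2 * ?e j k" for i
        by (simp add: power2_eq_square algebra_simps)
      have "?f (p, i) = (Q ^ ?e j k * inv_qpoch q (int j) * inv_qpoch Q (int k)) * (q ^ ((i\<^sup>2 + i) div 2 + i * j) / qpoch q q i)" for i
        unfolding Pair prod.case E power_add[of q _ "2 * ?e j k"] power_mult[of q 2] Q_def[symmetric] inv_qpoch_of_nat
        by (simp only: divide_inverse mult_ac)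
      moreover have "?N * (Q ^ ?e j k / (qpoch Q Q j * qpoch Q Q k)) = (Q ^ ?e j k * inv_qpoch q (int j) * inv_qpoch Q (int k)) * (?N / qpoch (- q) q j)"
        using qpoch_mult_neg[of q j, folded Q_def, symmetric] by (simp add: inv_qpoch_of_nat divide_inverse mult_ac)
      ultimately show ?thesis
        using has_sum_cmult_right[OF euler_sum_shifted[OF q, of j], of "Q ^ ?e j k * inv_qpoch q (int j) * inv_qpoch Q (int k)"]
        unfolding Pair prod.case by simp
    qed
    have "norm (?f x) \<le> (\<lambda>((j, k), i). norm q ^ j * norm q ^ k * norm q ^ i) x * C * C * D" for x
    proof -
      obtain i j k where x: "x = ((j, k), i)" by (cases x) auto
      have sq: "n \<le> n\<^sup>2" for n :: nat by (simp add: power2_eq_square)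
      have "i \<le> (i\<^sup>2 + i) div 2" using sq[of i] by simp
      then have "j + k + i \<le> ?E i j k" using sq[of j] sq[of k] by linarith
      then have "norm q ^ ?E i j k \<le> norm q ^ (j + k + i)"
        using q by (intro power_decreasing) auto
      then have "norm (q ^ ?E i j k) \<le> norm q ^ j * norm q ^ k * norm q ^ i"
        by (simp only: norm_power power_add[of _ "j + k" i] power_add[of _ j k])
      then show ?thesis unfolding x prod.case by (intro norm_mult_le C D)
    qed
    moreover have "(\<lambda>x. (\<lambda>((j, k), i). norm q ^ j * norm q ^ k * norm q ^ i) x * C * C * D) summable_on UNIV"
      using q by (intro summable_on_cmult_left geometric_triple_summable) auto
    ultimately have "(\<lambda>x. norm (?f x)) summable_on UNIV"
      by (intro Infinite_Sum.abs_summable_on_comparison_test') auto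
    then have "?f summable_on UNIV" by (rule abs_summable_summable)
    then show "?f summable_on (UNIV \<times> UNIV)" by simp
  qed
  then have "(?f has_sum (?N * (A / qpoch_inf Q Q))) UNIV" by simp
  also have "?this \<longleftrightarrow> ((\<lambda>(i, j, k). q ^ ?E i j k / (qpoch q q i * qpoch q q j * qpoch Q Q k)) has_sum (?N * (A / qpoch_inf Q Q))) UNIV"
    by (rule has_sum_reindex_bij_witness[of _ "\<lambda>(i, j, k). ((j, k), i)" "\<lambda>((j, k), i). (i, j, k)"])
      (auto simp: inv_qpoch_of_nat divide_inverse mult_ac)
  also have "?N * (A / qpoch_inf Q Q) = A / qpoch_inf q q"
    using qpoch_inf_mult_neg[OF q(1), folded Q_def] qpoch_inf_self_nonzero[OF Q(1)]
    by (auto simp: divide_simps mult.commute)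
  also have "A = qpoch_inf_list [q ^ (6 + 4 * a + 2 * c), q ^ (8 - 4 * a - 2 * c), q ^ 14] (q ^ 14)"
  proof -
    have "Q ^ n = q ^ (2 * n)" for n by (simp add: Q_def power_mult)
    then show ?thesis
      unfolding A_def qpoch_inf_list_def by (simp add: algebra_simps diff_mult_distrib2)
  qed
  finally show ?thesis unfolding Q_def .
qed

text \<open>
  The bilateral sums above contain negative powers of $q$, so $q = 0$ is treated apart: since $0^0 = 1$, a
  single term survives.
\<close>

lemma has_sum_base_zero:
  fixes e :: "nat \<Rightarrow> nat \<Rightarrow> nat \<Rightarrow> nat" and d :: "nat \<Rightarrow> nat \<Rightarrow> nat \<Rightarrow> complex"
  assumes "\<And>i j k. e i j k = 0 \<longleftrightarrow> i = 0 \<and> j = 0 \<and> k = 0" and "d 0 0 0 = 1"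
  shows "((\<lambda>(i, j, k). 0 ^ e i j k / d i j k) has_sum 1) UNIV"
  by (rule has_sum_finite_neutralI[of "{(0, 0, 0)}"]) (use assms in \<open>auto simp: power_0_left split: if_splits\<close>)

theorem theorem3p12:
  fixes q :: complex
  assumes "norm q < 1"
  shows "((\<lambda>(i::nat, j::nat, k::nat).
            q ^ ((i^2 + i) div 2 + 2 * j^2 + 4 * k^2 + i * j + 4 * j * k)
              / (qpoch q q i * qpoch q q j * qpoch (q^2) (q^2) k))
          has_sum (qpoch_inf_list [q^6, q^8, q^14] (q^14) / qpoch_inf q q)) UNIV
       \<and> ((\<lambda>(i::nat, j::nat, k::nat).
            q ^ ((i^2 + i) div 2 + 2 * j^2 + 4 * k^2 + i * j + 4 * j * k + 2 * k)
              / (qpoch q q i * qpoch q q j * qpoch (q^2) (q^2) k))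
          has_sum (qpoch_inf_list [q^4, q^10, q^14] (q^14) / qpoch_inf q q)) UNIV
       \<and> ((\<lambda>(i::nat, j::nat, k::nat).
            q ^ ((i^2 + i) div 2 + 2 * j^2 + 4 * k^2 + i * j + 4 * j * k + 2 * j + 4 * k)
              / (qpoch q q i * qpoch q q j * qpoch (q^2) (q^2) k))
          has_sum (qpoch_inf_list [q^2, q^12, q^14] (q^14) / qpoch_inf q q)) UNIV"
proof (cases "q = 0")
  case True
  have products: "qpoch_inf_list [0 ^ 6, 0 ^ 8, 0 ^ 14] (0 ^ 14) / qpoch_inf 0 0 = 1"
    "qpoch_inf_list [0 ^ 4, 0 ^ 10, 0 ^ 14] (0 ^ 14) / qpoch_inf 0 0 = 1"
    "qpoch_inf_list [0\<^sup>2, 0 ^ 12, 0 ^ 14] (0 ^ 14) / qpoch_inf 0 0 = 1"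
    by (simp_all add: qpoch_inf_list_def qpoch_inf_def)
  have half: "((i\<^sup>2 + i) div 2 = 0) \<longleftrightarrow> i = 0" for i :: nat
    by (cases i) (auto simp: power2_eq_square)
  show ?thesis
    unfolding True products by (intro conjI has_sum_base_zero) (auto simp: half qpoch_def)
next
  case False
  have 1: "qpoch_inf_list [x, y, z] w = qpoch_inf_list [y, x, z] w" for x y z w
    by (simp add: qpoch_inf_list_def mult_ac)
  show ?thesis
    \<comment> \<open>the three cases are \<open>(a, c) = (0, 0)\<close>, \<open>(1, 0)\<close> and \<open>(1, 1)\<close>; in the last two the first two factors come in the other order\<close>
    using triple_sum[OF assms False, of 0 0] triple_sum[OF assms False, of 0 1] triple_sum[OF assms False, of 1 1]
      1[of "q ^ 10"] 1[of "q ^ 12"]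
    by (simp add: add_ac distrib_left)
qed

end
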